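(* Let $\Lambda$ and $X$ be finite nonempty sets. Every random field $P_\Lambda$ on $X^\Lambda$ that is positive (i.e. $P_\Lambda(x)>0$ for all $x\in X^\Lambda$) is Gibbsian.
   Context: Each point $t\in\Lambda$ is associated with a copy $X^t$ of $X$. For $V\subseteq\Lambda$, $X^V=\{(x_t)_{t\in V}: x_t\in X^t\}$ is the set of configurations on $V$ (with $X^\emptyset$ consisting of the empty configuration only), and $X^{\{t\}}$ is identified with $X^t$. For disjoint $V,I\subset\Lambda$ and $x\in X^V$, $y\in X^I$, $xy\in X^{V\cup I}$ denotes the concatenation: the configuration equal to $x$ on $V$ and to $y$ on $I$ (the order of writing is irrelevant). A random field $P_\Lambda$ is a probability distribution on $X^\Lambda$. For positive $P_\Lambda$ its one-point conditional distribution is the family of $$Q_t^z(x)=\frac{P_\Lambda(xz)}{\sum_{u\in X^t}P_\Lambda(uz)},\qquad x\in X^t,\ z\in X^{\Lambda\setminus\{t\}},\ t\in\Lambda.$$ A (one-point) transition energy field in $\Lambda$ is a family $\mathbf{\Delta}_1=\{\Delta_t^z : t\in\Lambda,\ z\in X^{\Lambda\setminus\{t\}}\}$ of functions $\Delta_t^z: X^t\times X^t\to\mathbb{R}$ such that: (a) for all $t\in\Lambda$, $z\in X^{\Lambda\setminus\{t\}}$ and $x,u,\alpha\in X^t$: $\Delta_t^z(x,u)=\Delta_t^z(x,\alpha)+\Delta_t^z(\alpha,u)$; (b) for all distinct $t,s\in\Lambda$ and all $x,u\in X^t$, $y,v\in X^s$, $z\in X^{\Lambda\setminus\{t,s\}}$: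 $\Delta_t^{zy}(x,u)+\Delta_s^{zu}(y,v)=\Delta_s^{zx}(y,v)+\Delta_t^{zv}(x,u)$. A random field $P_\Lambda$ is called Gibbsian if there is a one-point transition energy field $\mathbf{\Delta}_1$ in $\Lambda$ such that for all $t\in\Lambda$, $z\in X^{\Lambda\setminus\{t\}}$ and $u\in X^t$, $$Q_t^z(x)=\frac{\exp\{\Delta_t^z(x,u)\}}{\sum_{\alpha\in X^t}\exp\{\Delta_t^z(\alpha,u)\}},\qquad x\in X^t .$$ *)

theory Defs
  imports "HOL-Probability.Probability"
begin

text \<open>
  A configuration on V is an extensional function, i.e. an element of the library's dependent
  product \<^term>\<open>PiE V (\<lambda>_. X)\<close>; for empty V this contains exactly one (the empty) configuration.
  Via the identification of configurations on a single point t with elements of X, the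
  concatenation of a configuration z on V with a value x at a point t outside V is the function
  update \<^term>\<open>z(t := x)\<close>, which is a configuration on \<^term>\<open>insert t V\<close>.
\<close>

definition configs :: "'i set \<Rightarrow> 'a set \<Rightarrow> ('i \<Rightarrow> 'a) set" where
  "configs V X = PiE V (\<lambda>_. X)"

definition random_field :: "'i set \<Rightarrow> 'a set \<Rightarrow> ('i \<Rightarrow> 'a) pmf \<Rightarrow> bool" where
  "random_field \<Lambda> X P \<longleftrightarrow> set_pmf P \<subseteq> configs \<Lambda> X"

definition positive_field :: "'i set \<Rightarrow> 'a set \<Rightarrow> ('i \<Rightarrow> 'a) pmf \<Rightarrow> bool" where
  "positive_field \<Lambda> X P \<longleftrightarrow> (\<forall>x \<in> configs \<Lambda> X. pmf P x > 0)"

text \<open>Meaningful for positive random fields, t in \<open>\<Lambda>\<close>, z a configuration on \<open>\<Lambda> - {t}\<close>, x in X.\<close>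

definition one_point_cond ::
    "'a set \<Rightarrow> ('i \<Rightarrow> 'a) pmf \<Rightarrow> 'i \<Rightarrow> ('i \<Rightarrow> 'a) \<Rightarrow> 'a \<Rightarrow> real" where
  "one_point_cond X P t z x = pmf P (z(t := x)) / (\<Sum>u\<in>X. pmf P (z(t := u)))"

text \<open>\<open>\<Delta> t z x u\<close> is the energy of the transition at t from x to u under boundary condition z.\<close>

definition transition_energy_field ::
    "'i set \<Rightarrow> 'a set \<Rightarrow> ('i \<Rightarrow> ('i \<Rightarrow> 'a) \<Rightarrow> 'a \<Rightarrow> 'a \<Rightarrow> real) \<Rightarrow> bool" where
  "transition_energy_field \<Lambda> X \<Delta> \<longleftrightarrow>
     (\<forall>t\<in>\<Lambda>. \<forall>z\<in>configs (\<Lambda> - {t}) X. \<forall>x\<in>X. \<forall>u\<in>X. \<forall>\<alpha>\<in>X.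
        \<Delta> t z x u = \<Delta> t z x \<alpha> + \<Delta> t z \<alpha> u) \<and>
     (\<forall>t\<in>\<Lambda>. \<forall>s\<in>\<Lambda>. t \<noteq> s \<longrightarrow>
        (\<forall>x\<in>X. \<forall>u\<in>X. \<forall>y\<in>X. \<forall>v\<in>X. \<forall>z\<in>configs (\<Lambda> - {t, s}) X.
           \<Delta> t (z(s := y)) x u + \<Delta> s (z(t := u)) y v =
           \<Delta> s (z(t := x)) y v + \<Delta> t (z(s := v)) x u))"

definition gibbsian :: "'i set \<Rightarrow> 'a set \<Rightarrow> ('i \<Rightarrow> 'a) pmf \<Rightarrow> bool" where
  "gibbsian \<Lambda> X P \<longleftrightarrow>
     (\<exists>\<Delta>. transition_energy_field \<Lambda> X \<Delta> \<and>
        (\<forall>t\<in>\<Lambda>. \<forall>z\<in>configs (\<Lambda> - {t}) X. \<forall>u\<in>X. \<forall>x\<in>X.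
           one_point_cond X P t z x = exp (\<Delta> t z x u) / (\<Sum>\<alpha>\<in>X. exp (\<Delta> t z \<alpha> u))))"

end

theory Submission imports Defs begin

text \<open>Read \<open>- ln (pmf P x)\<close> as the energy of a configuration \<open>x\<close>,
  and let \<Delta> be the energy difference between the two configurations that agree with
  \<open>z\<close> off \<open>t\<close>. Differences of a potential are additive and
  path-independent, which gives both axioms. Exponentiating turns them into ratios of probabilities,
  whose normalization is the one-point conditional distribution.\<close>

lemma fun_upd_in_configs:
  assumes "z \<in> configs (\<Lambda> - {t}) X" "t \<in> \<Lambda>" "x \<in> X"
  shows "z(t := x) \<in> configs \<Lambda> X"
  using assms unfolding configs_def by (metis PiE_fun_upd insert_Diff)

theorem theorem4:
  fixes \<Lambda> :: "'i set" and X :: "'a set" and P :: "('i \<Rightarrow> 'a) pmf"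
  assumes "finite \<Lambda>" and "\<Lambda> \<noteq> {}"
    and "finite X" and "X \<noteq> {}"
    and "random_field \<Lambda> X P"
    and "positive_field \<Lambda> X P"
  shows "gibbsian \<Lambda> X P"
proof -
  define \<Delta> where "\<Delta> t z x u = ln (pmf P (z(t := x))) - ln (pmf P (z(t := u)))" for t z x u
  \<comment> \<open>Both sides of the two-point identity telescope to the log-probability at
    \<open>x\<close>, \<open>y\<close> minus that at \<open>u\<close>, \<open>v\<close>, once
    updates at distinct points are commuted.\<close>
  have "transition_energy_field \<Lambda> X \<Delta>"
    by (auto simp: transition_energy_field_def \<Delta>_def fun_upd_twist)
  moreover have "one_point_cond X P t z x = exp (\<Delta> t z x u) / (\<Sum>\<alpha>\<in>X. exp (\<Delta> t z \<alpha> u))"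
    if "t \<in> \<Lambda>" "z \<in> configs (\<Lambda> - {t}) X" "u \<in> X" "x \<in> X" for t z u x
  proof -
    have pos: "pmf P (z(t := y)) > 0" if "y \<in> X" for y
      using assms(6) fun_upd_in_configs[OF \<open>z \<in> _\<close> \<open>t \<in> \<Lambda>\<close> that]
      by (simp add: positive_field_def)
    have energy: "exp (\<Delta> t z y u) = pmf P (z(t := y)) / pmf P (z(t := u))" if "y \<in> X" for y
      using pos[OF that] pos[OF \<open>u \<in> X\<close>] by (simp add: \<Delta>_def exp_diff)
    \<comment> \<open>The denominator carries the same factor \<open>1 / pmf P (z(t := u))\<close>
      as the numerator; it is nonzero and cancels, so the reference value \<open>u\<close> drops
      out.\<close>
    have "(\<Sum>\<alpha>\<in>X. exp (\<Delta> t z \<alpha> u)) = (\<Sum>\<alpha>\<in>X. pmf P (z(t := \<alpha>))) / pmf P (z(t := u))"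
      by (simp add: energy sum_divide_distrib)
    then show ?thesis
      using energy[OF \<open>x \<in> X\<close>] pos[OF \<open>u \<in> X\<close>] by (simp add: one_point_cond_def)
  qed
  ultimately show ?thesis
    unfolding gibbsian_def by blast
qed

end
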